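(* Let $\beta<\mathfrak{b}$ and let $(\mathcal{A}_\alpha)_{\alpha<\beta}$ be an increasing (with respect to inclusion) sequence of families of subsets of $\omega$ such that no $\mathcal{A}_\alpha$ is an external quasi-subbase of any contour. Then $\bigcup_{\alpha<\beta}\mathcal{A}_\alpha$ is not an external quasi-subbase of any contour.
   Context: $\mathfrak{b}$ is the bounding number: the least cardinality of a family of functions in $\omega^\omega$ not dominated by a single function (i.e. there is no $g$ with $f(n)\le g(n)$ for almost all $n$ for every $f$ in the family). A family of sets has the strong finite intersection property (sfip) if every finite subfamily has infinite intersection; for such a family $\mathcal{A}$, $\langle\mathcal{A}\rangle$ is the filter it generates. For a partition $\mathcal{W}=\{W_n:n<\omega\}$ of a subset of $\omega$ into infinite pairwise disjoint sets, the contour $\int\mathcal{W}$ is the filter of all $W\subseteq\omega$ for which there is a cofinite $I\subseteq\omega$ such that $W\cap W_n$ is cofinite in $W_n$ for every $n\in I$; a contour is a filter of this form. A family $\mathcal{A}$ is an external quasi-subbase (EQ-subbase) of a filter $\mathcal{F}$ if there is a countable family $\mathcal{B}$ such that $\mathcal{A}\cup\mathcal{B}$ has the sfip and $\mathcal{F}\subseteq\langle\mathcal{A}\cup\mathcal{B}\rangle$. *)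

theory Defs
  imports Main "HOL-Library.Countable_Set" "HOL-Library.Disjoint_Sets"
begin

unbundle cardinal_syntax

definition dominated :: "(nat \<Rightarrow> nat) set \<Rightarrow> bool" where
  "dominated F \<longleftrightarrow> (\<exists>g. \<forall>f\<in>F. \<forall>\<^sub>F n in cofinite. f n \<le> g n)"

text \<open>
  Cardinals are rendered as in the library, namely as initial well-orders, so that
  \<open><o\<close> compares an arbitrary well-order (an ordinal) with a cardinal.
\<close>

definition bounding_number :: "(nat \<Rightarrow> nat) rel" where
  "bounding_number =
     |SOME F. \<not> dominated F \<and> (\<forall>G. \<not> dominated G \<longrightarrow> |F| \<le>o |G| )|"

lemma not_dominated_UNIV: "\<not> dominated UNIV"
proof
  assume "dominated UNIV"
  then obtain g :: "nat \<Rightarrow> nat" where "\<forall>f\<in>UNIV. \<forall>\<^sub>F n in cofinite. f n \<le> g n"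
    unfolding dominated_def by blast
  from bspec[OF this UNIV_I, of "\<lambda>n. Suc (g n)"] show False
    by (simp add: eventually_cofinite)
qed

lemma bounding_number_witness:
  "\<exists>F. \<not> dominated F \<and> (\<forall>G. \<not> dominated G \<longrightarrow> |F| \<le>o |G| ) \<and> bounding_number = |F|"
proof -
  let ?R = "card_of ` {F. \<not> dominated F}"
  have "?R \<noteq> {}" using not_dominated_UNIV by blast
  moreover have "\<forall>r\<in>?R. Card_order r" by (simp add: card_of_Card_order)
  ultimately have "\<exists>r\<in>?R. \<forall>r'\<in>?R. r \<le>o r'"
    by (rule exists_minim_Card_order)
  then have "\<exists>F. \<not> dominated F \<and> (\<forall>G. \<not> dominated G \<longrightarrow> |F| \<le>o |G| )"
    by simp
  from someI_ex[OF this] bounding_number_def show ?thesis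
    by (intro exI[of _ "SOME F. \<not> dominated F \<and> (\<forall>G. \<not> dominated G \<longrightarrow> |F| \<le>o |G| )"])
       (elim conjE, intro conjI)
qed

definition sfip :: "'a set set \<Rightarrow> bool" where
  "sfip \<A> \<longleftrightarrow> (\<forall>\<F>. finite \<F> \<and> \<F> \<subseteq> \<A> \<longrightarrow> infinite (\<Inter>\<F>))"

definition filter_generated :: "'a set set \<Rightarrow> 'a filter" where
  "filter_generated \<A> = (INF X\<in>\<A>. principal X)"

lemma eventually_filter_generated:
  "eventually P (filter_generated \<A>) \<longleftrightarrow>
     (\<exists>\<F>. finite \<F> \<and> \<F> \<subseteq> \<A> \<and> \<Inter>\<F> \<subseteq> {x. P x})"
proof -
  have *: "(INF X\<in>\<F>. principal X) = principal (\<Inter>\<F>)" if "finite \<F>" for \<F> :: "'a set set"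
    using INF_principal_finite[OF that, of "\<lambda>X. X"] by simp
  show ?thesis
    unfolding filter_generated_def
    by (subst eventually_INF, rule ex_cong1) (auto simp: * eventually_principal subset_iff)
qed

definition contour :: "(nat \<Rightarrow> 'a set) \<Rightarrow> 'a filter" where
  "contour W = Abs_filter (\<lambda>P. \<exists>I. finite (- I) \<and> (\<forall>n\<in>I. finite (W n - {x. P x})))"

lemma eventually_contour:
  "eventually P (contour W) \<longleftrightarrow>
     (\<exists>I. finite (- I) \<and> (\<forall>n\<in>I. finite (W n - {x. P x})))"
  unfolding contour_def
proof (rule eventually_Abs_filter, rule is_filter.intro, goal_cases)
  case 1
  show ?case by (rule exI[of _ UNIV]) simp
next
  case (2 P Q)
  then obtain I J where IJ: "finite (- I)" "\<forall>n\<in>I. finite (W n - {x. P x})"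
    "finite (- J)" "\<forall>n\<in>J. finite (W n - {x. Q x})" by blast
  have "W n - {x. P x \<and> Q x} = (W n - {x. P x}) \<union> (W n - {x. Q x})" for n by blast
  with IJ show ?case by (intro exI[of _ "I \<inter> J"]) simp
next
  case (3 P Q)
  then obtain I where I: "finite (- I)" "\<forall>n\<in>I. finite (W n - {x. P x})" by blast
  have "W n - {x. Q x} \<subseteq> W n - {x. P x}" for n using 3 by blast
  with I show ?case by (intro exI[of _ I]) (auto intro: finite_subset)
qed

definition is_contour :: "'a filter \<Rightarrow> bool" where
  "is_contour F \<longleftrightarrow>
     (\<exists>W. disjoint_family W \<and> (\<forall>n. infinite (W n)) \<and> F = contour W)"

text \<open>
  The library orders filters by reverse inclusion: \<open>G \<le> F\<close> says that every member of
  \<open>F\<close> is a member of \<open>G\<close>.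
\<close>

definition EQ_subbase :: "'a set set \<Rightarrow> 'a filter \<Rightarrow> bool" where
  "EQ_subbase \<A> F \<longleftrightarrow>
     (\<exists>\<B>. countable \<B> \<and> sfip (\<A> \<union> \<B>) \<and> filter_generated (\<A> \<union> \<B>) \<le> F)"

end

(* For f in the Baire space let U f be the set of those x that exceed f n whenever they lie in W n.
   Up to the tails "union of the W n with n \<ge> m", the sets U f form a base of the contour of W, and
   U g is included in U f modulo a tail once g dominates f. Suppose the union of the families,
   together with a countable family B, generates a filter finer than this contour; adding the
   countably many tails to B is harmless. Each single family misses some U (f i), and since there
   are fewer than b indices, one g dominates all f i. Then U g lies in none of the filters generated
   by a single family and B, hence not in their directed union. Without any index, the countable B
   alone would have to refine the contour, which a diagonal argument excludes. *)
theory Submission imports Defs begin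

lemma filter_generated_Un:
  "filter_generated (\<A> \<union> \<B>) = inf (filter_generated \<A>) (filter_generated \<B>)"
  unfolding filter_generated_def by (rule INF_union)

lemma filter_generated_le_principal:
  "X \<in> \<A> \<Longrightarrow> filter_generated \<A> \<le> principal X"
  unfolding filter_generated_def by (rule INF_lower)

lemma le_filter_generated_iff:
  "F \<le> filter_generated \<A> \<longleftrightarrow> (\<forall>X\<in>\<A>. F \<le> principal X)"
  unfolding filter_generated_def by (rule le_INF_iff)

text \<open>This makes \<open>sfip\<close> a property of the generated filter alone, so it passes
  between families that generate the same filter.\<close>

lemma sfip_iff_eventually_infinite:
  "sfip \<A> \<longleftrightarrow> (\<forall>P. eventually P (filter_generated \<A>) \<longrightarrow> infinite {x. P x})"
proof
  assume "sfip \<A>"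
  then show "\<forall>P. eventually P (filter_generated \<A>) \<longrightarrow> infinite {x. P x}"
    unfolding sfip_def eventually_filter_generated by (meson infinite_super)
next
  assume R: "\<forall>P. eventually P (filter_generated \<A>) \<longrightarrow> infinite {x. P x}"
  show "sfip \<A>"
    unfolding sfip_def
  proof (intro allI impI)
    fix \<F> assume "finite \<F> \<and> \<F> \<subseteq> \<A>"
    then have "eventually (\<lambda>x. x \<in> \<Inter>\<F>) (filter_generated \<A>)"
      unfolding eventually_filter_generated by blast
    with R have "infinite {x. x \<in> \<Inter>\<F>}" by blast
    then show "infinite (\<Inter>\<F>)" unfolding Collect_mem_eq .
  qed
qed

lemma sfip_subset: "sfip \<B> \<Longrightarrow> \<A> \<subseteq> \<B> \<Longrightarrow> sfip \<A>"
  unfolding sfip_def by blast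

lemma contour_le_principal_tail: "contour W \<le> principal (\<Union>n\<in>{m..}. W n)"
  unfolding le_principal eventually_contour
proof (intro exI conjI ballI)
  show "finite (- {m..})" by (simp add: Compl_atLeast)
  fix n assume "n \<in> {m..}"
  then have empty: "W n - {x. x \<in> (\<Union>n\<in>{m..}. W n)} = {}" by blast
  show "finite (W n - {x. x \<in> (\<Union>n\<in>{m..}. W n)})" unfolding empty by simp
qed

text \<open>By disjointness a point of \<open>W n\<close> faces only the bound \<open>f n\<close>,
  so at most the finitely many points up to \<open>f n\<close> drop out of
  \<open>W n\<close>.\<close>

lemma eventually_contour_above:
  fixes W :: "nat \<Rightarrow> nat set"
  assumes "disjoint_family W"
  shows "eventually (\<lambda>x. \<forall>n. x \<in> W n \<longrightarrow> f n < x) (contour W)"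
  unfolding eventually_contour
proof (intro exI conjI ballI)
  show "finite (- (UNIV :: nat set))" by simp
  fix n
  have "W n - {x. \<forall>n. x \<in> W n \<longrightarrow> f n < x} \<subseteq> {..f n}"
  proof
    fix x assume x: "x \<in> W n - {x. \<forall>n. x \<in> W n \<longrightarrow> f n < x}"
    then obtain k where "x \<in> W k" "\<not> f k < x" by blast
    moreover from this x assms have "k = n" unfolding disjoint_family_on_def by blast
    ultimately show "x \<in> {..f n}" by simp
  qed
  then show "finite (W n - {x. \<forall>n. x \<in> W n \<longrightarrow> f n < x})"
    by (rule finite_subset) simp
qed

text \<open>Take \<open>m\<close> beyond the finitely many exceptional indices, and let
  \<open>f n\<close> bound the finitely many points of \<open>W n\<close> at which \<open>P\<close>
  fails.\<close>

lemma eventually_contourD: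
  fixes W :: "nat \<Rightarrow> nat set"
  assumes "eventually P (contour W)"
  obtains f m where "\<And>x. x \<in> (\<Union>n\<in>{m..}. W n) \<Longrightarrow> (\<forall>n. x \<in> W n \<longrightarrow> f n < x) \<Longrightarrow> P x"
proof -
  from assms obtain I where I: "finite (- I)" "\<And>n. n \<in> I \<Longrightarrow> finite (W n - {x. P x})"
    unfolding eventually_contour by blast
  from I(1) obtain m where m: "\<And>n. n \<in> - I \<Longrightarrow> n < m"
    by (meson finite_nat_set_iff_bounded)
  have "\<forall>n\<in>I. \<exists>k. \<forall>x\<in>W n - {x. P x}. x \<le> k"
    using I(2) by (meson finite_nat_set_iff_bounded_le)
  then obtain f where f: "\<And>n x. n \<in> I \<Longrightarrow> x \<in> W n - {x. P x} \<Longrightarrow> x \<le> f n"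
    by metis
  show thesis
  proof (rule that)
    fix x assume "x \<in> (\<Union>n\<in>{m..}. W n)" and *: "\<forall>n. x \<in> W n \<longrightarrow> f n < x"
    then obtain n where n: "n \<ge> m" "x \<in> W n" by auto
    then have "n \<in> I" using m[of n] by auto
    with n f[of n x] * show "P x" by (auto simp: not_less[symmetric])
  qed
qed

text \<open>Diagonalization: a sequence picks its n-th point from the n-th finite intersection of
  \<open>\<B>\<close> and from the n-th tail. Its range meets each \<open>W k\<close> in a finite
  set, so the complement belongs to the contour; yet this complement contains no finite intersection
  of \<open>\<B>\<close>.\<close>

lemma countable_not_le_contour:
  assumes "countable \<B>" and "sfip \<B>" and "disjoint_family W"
  shows "\<not> filter_generated \<B> \<le> contour W"
proof
  assume le: "filter_generated \<B> \<le> contour W"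
  let ?S = "{\<F>. finite \<F> \<and> \<F> \<subseteq> \<B>}"
  \<comment> \<open>\<open>C\<close> runs through all finite intersections, possibly with
    repetitions; \<open>?S\<close> is nonempty because it contains \<open>{}\<close>.\<close>
  define C where "C n = \<Inter> (from_nat_into ?S n)" for n
  have cnt: "countable ?S" using assms(1) by (rule countable_Collect_finite_subset)
  have "\<exists>x. x \<in> C n \<and> x \<in> (\<Union>k\<in>{n..}. W k)" for n
  proof -
    have "from_nat_into ?S n \<in> ?S" by (rule from_nat_into) blast
    then have "eventually (\<lambda>x. x \<in> C n) (filter_generated \<B>)"
      unfolding eventually_filter_generated C_def by blast
    moreover have "eventually (\<lambda>x. x \<in> (\<Union>k\<in>{n..}. W k)) (filter_generated \<B>)"
      using order_trans[OF le contour_le_principal_tail[of W n]] unfolding le_principal .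
    ultimately have "infinite {x. x \<in> C n \<and> x \<in> (\<Union>k\<in>{n..}. W k)}"
      using assms(2) unfolding sfip_iff_eventually_infinite
      by (blast intro: eventually_conj)
    then show ?thesis using infinite_imp_nonempty by blast
  qed
  then obtain x where x: "\<And>n. x n \<in> C n" "\<And>n. x n \<in> (\<Union>k\<in>{n..}. W k)"
    by metis
  have "eventually (\<lambda>y. y \<notin> range x) (contour W)"
    unfolding eventually_contour
  proof (intro exI conjI ballI)
    show "finite (- (UNIV :: nat set))" by simp
    fix k
    \<comment> \<open>The point \<open>x n\<close> lies in some \<open>W l\<close> with
      \<open>l \<ge> n\<close>, so \<open>W k\<close> can only contain points among
      \<open>x 0\<close>, ..., \<open>x k\<close>.\<close>
    have "n \<le> k" if "x n \<in> W k" for n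
    proof -
      from x(2)[of n] obtain l where "n \<le> l" "x n \<in> W l" by auto
      moreover from this that assms(3) have "k = l" unfolding disjoint_family_on_def by blast
      ultimately show ?thesis by simp
    qed
    then have "W k - {y. y \<notin> range x} \<subseteq> x ` {..k}" by auto
    then show "finite (W k - {y. y \<notin> range x})" by (rule finite_subset) simp
  qed
  then have "eventually (\<lambda>y. y \<notin> range x) (filter_generated \<B>)"
    using le by (rule filter_leD[rotated])
  then obtain \<F> where \<F>: "\<F> \<in> ?S" "\<Inter>\<F> \<subseteq> {y. y \<notin> range x}"
    unfolding eventually_filter_generated by blast
  with cnt obtain n where "C n = \<Inter>\<F>"
    unfolding C_def by (metis from_nat_into_surj)
  with x(1)[of n] \<F>(2) show False by blast
qed

text \<open>An image of the field has at most as many elements as the ordinal, hence fewer than any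
  undominated family.\<close>

lemma dominated_if_less_bounding_number:
  assumes "Well_order \<beta>" and "\<beta> <o bounding_number"
  shows "dominated (f ` Field \<beta>)"
proof (rule ccontr)
  assume nd: "\<not> dominated (f ` Field \<beta>)"
  from bounding_number_witness have "bounding_number \<le>o |f ` Field \<beta>|"
    using nd by metis
  also have "|f ` Field \<beta>| \<le>o |Field \<beta>|" by (rule card_of_image)
  also have "|Field \<beta>| \<le>o \<beta>"
    using assms(1) by (simp add: card_of_least)
  finally show False using assms(2) not_ordLess_ordLeq by blast
qed

text \<open>Only finitely many generators witness an event, and a finite part of the union of a
  chain lies in a single member.\<close>

lemma eventually_filter_generated_chain:
  assumes "Well_order \<beta>" and "\<And>i j. (i, j) \<in> \<beta> \<Longrightarrow> \<A> i \<subseteq> \<A> j" and "Field \<beta> \<noteq> {}"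
    and "eventually P (filter_generated ((\<Union>i\<in>Field \<beta>. \<A> i) \<union> \<B>))"
  obtains i where "i \<in> Field \<beta>" and "eventually P (filter_generated (\<A> i \<union> \<B>))"
proof -
  \<comment> \<open>With at least one index, \<open>\<B>\<close> can be distributed over the union,
    which makes the union one of the chain \<open>\<A> i \<union> \<B>\<close>.\<close>
  from assms(4) obtain \<F> where \<F>: "finite \<F>" "\<F> \<subseteq> (\<Union>i\<in>Field \<beta>. \<A> i \<union> \<B>)" "\<Inter>\<F> \<subseteq> {x. P x}"
    using assms(3) unfolding eventually_filter_generated by auto
  have "i = j \<or> (i, j) \<in> \<beta> \<or> (j, i) \<in> \<beta>" if "i \<in> Field \<beta>" "j \<in> Field \<beta>" for i j
    using assms(1) that unfolding well_order_on_def linear_order_on_def total_on_def by blast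
  then have "subset.chain UNIV ((\<lambda>i. \<A> i \<union> \<B>) ` Field \<beta>)"
    unfolding subset_chain_def using assms(2) by blast
  with \<F>(1,2) assms(3) obtain i where "i \<in> Field \<beta>" "\<F> \<subseteq> \<A> i \<union> \<B>"
    using finite_subset_Union_chain[of \<F> "(\<lambda>i. \<A> i \<union> \<B>) ` Field \<beta>" UNIV] by blast
  with \<F>(1,3) show thesis
    by (intro that[of i]) (auto simp: eventually_filter_generated)
qed

theorem theorem1:
  fixes \<beta> :: "'i rel" and \<A> :: "'i \<Rightarrow> nat set set"
  assumes "Well_order \<beta>"
    and "\<beta> <o bounding_number"
    and "\<And>i j. (i, j) \<in> \<beta> \<Longrightarrow> \<A> i \<subseteq> \<A> j"
    and "\<And>i. i \<in> Field \<beta> \<Longrightarrow> \<nexists>F. is_contour F \<and> EQ_subbase (\<A> i) F"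
  shows "\<nexists>F. is_contour F \<and> EQ_subbase (\<Union>i\<in>Field \<beta>. \<A> i) F"
proof
  let ?\<A> = "\<Union>i\<in>Field \<beta>. \<A> i"
  assume "\<exists>F. is_contour F \<and> EQ_subbase ?\<A> F"
  then obtain W \<C> where W: "disjoint_family W" "\<And>n. infinite (W n)"
    and \<C>: "countable \<C>" "sfip (?\<A> \<union> \<C>)" "filter_generated (?\<A> \<union> \<C>) \<le> contour W"
    unfolding is_contour_def EQ_subbase_def by blast
  define V where "V m = (\<Union>n\<in>{m..}. W n)" for m
  define U where "U f x \<longleftrightarrow> (\<forall>n. x \<in> W n \<longrightarrow> f n < x)" for f :: "nat \<Rightarrow> nat" and x
  \<comment> \<open>The tails belong to the filter of the whole union, but a single
    \<open>\<A> i\<close> with \<open>\<C>\<close> need not generate them. Inside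
    \<open>\<B>\<close> they are available for every index.\<close>
  define \<B> where "\<B> = \<C> \<union> range V"
  have "filter_generated (?\<A> \<union> \<C>) \<le> filter_generated (range V)"
    using \<C>(3) contour_le_principal_tail[of W]
    unfolding le_filter_generated_iff V_def by (blast intro: order_trans)
  then have eq: "filter_generated (?\<A> \<union> \<B>) = filter_generated (?\<A> \<union> \<C>)"
    unfolding \<B>_def Un_assoc[symmetric] filter_generated_Un[of "?\<A> \<union> \<C>"] by (rule inf_absorb1)
  have \<B>: "countable \<B>" "sfip (?\<A> \<union> \<B>)" "filter_generated (?\<A> \<union> \<B>) \<le> contour W"
    using \<C> unfolding sfip_iff_eventually_infinite eq by (simp_all add: \<B>_def)
  have V: "eventually (\<lambda>x. x \<in> V m) (filter_generated (\<A> i \<union> \<B>))" for i m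
    using filter_generated_le_principal[of "V m" "\<A> i \<union> \<B>"]
    unfolding le_principal \<B>_def by blast
  have "\<exists>f. \<not> eventually (U f) (filter_generated (\<A> i \<union> \<B>))" if i: "i \<in> Field \<beta>" for i
  proof -
    \<comment> \<open>With \<open>\<B>\<close> countable and sfip inherited from the larger family,
      \<open>EQ_subbase\<close> can fail only because the contour is not refined.\<close>
    have "sfip (\<A> i \<union> \<B>)" using \<B>(2) by (rule sfip_subset) (use i in blast)
    moreover have "is_contour (contour W)" using W unfolding is_contour_def by blast
    ultimately have "\<not> filter_generated (\<A> i \<union> \<B>) \<le> contour W"
      using assms(4)[OF i] \<B>(1) unfolding EQ_subbase_def by blast
    then obtain P where P: "eventually P (contour W)"
        "\<not> eventually P (filter_generated (\<A> i \<union> \<B>))"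
      unfolding le_filter_def by blast
    from P(1) obtain f m where fm: "\<And>x. x \<in> V m \<Longrightarrow> U f x \<Longrightarrow> P x"
      unfolding U_def V_def by (rule eventually_contourD) blast
    \<comment> \<open>Since \<open>V m\<close> is a generator, having \<open>U f\<close> in this
      filter would force the missing set \<open>P\<close> into it.\<close>
    have "eventually P (filter_generated (\<A> i \<union> \<B>))"
      if "eventually (U f) (filter_generated (\<A> i \<union> \<B>))"
      using V[of m i] that by eventually_elim (rule fm)
    with P(2) show ?thesis by blast
  qed
  then obtain f where f: "\<And>i. i \<in> Field \<beta> \<Longrightarrow>
      \<not> eventually (U (f i)) (filter_generated (\<A> i \<union> \<B>))"
    by metis
  from dominated_if_less_bounding_number[OF assms(1,2), of f] obtain g
    where g: "\<And>i. i \<in> Field \<beta> \<Longrightarrow> \<forall>\<^sub>F n in cofinite. f i n \<le> g n"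
    unfolding dominated_def by blast
  have Ug: "eventually (U g) (filter_generated (?\<A> \<union> \<B>))"
    using \<B>(3) eventually_contour_above[OF W(1), of g] unfolding U_def by (rule filter_leD)
  \<comment> \<open>Over an empty field the union is empty, and \<open>\<B>\<close> alone would
    refine the contour.\<close>
  have "Field \<beta> \<noteq> {}"
    using countable_not_le_contour[OF \<B>(1) _ W(1)] \<B>(2,3) by auto
  with assms(1,3) obtain i where i: "i \<in> Field \<beta>"
      "eventually (U g) (filter_generated (\<A> i \<union> \<B>))"
    using Ug by (rule eventually_filter_generated_chain)
  from g[OF i(1)] obtain m where m: "\<And>n. m \<le> n \<Longrightarrow> f i n \<le> g n"
    unfolding cofinite_eq_sequentially eventually_sequentially by blast
  \<comment> \<open>By disjointness a point of \<open>V m\<close> lies in exactly one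
    \<open>W n\<close>, with \<open>n \<ge> m\<close>, where \<open>g n\<close> is at least
    \<open>f i n\<close>.\<close>
  have sub: "U (f i) x" if "x \<in> V m" "U g x" for x
    unfolding U_def
  proof (intro allI impI)
    fix n assume n: "x \<in> W n"
    from that(1) obtain k where "m \<le> k" "x \<in> W k" unfolding V_def by auto
    moreover from this n W(1) have "k = n" unfolding disjoint_family_on_def by blast
    ultimately have "m \<le> n" by simp
    with m[of n] n that(2) show "f i n < x" unfolding U_def by (meson le_less_trans)
  qed
  have "eventually (U (f i)) (filter_generated (\<A> i \<union> \<B>))"
    using V[of m i] i(2) by eventually_elim (rule sub)
  with f[OF i(1)] show False by blast
qed

end
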